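(* Let $\alpha>1$ be irrational, $\gamma=\alpha^{-1}$, and $\kappa=\lceil\alpha\rceil$. Then the lower bound $$\psi^{(\kappa)}(x)\geq\frac{(\kappa\gamma-1)^{\kappa-1}}{2^{\kappa-2}(\kappa-1)!}$$ holds uniformly for all $x\in\mathbb{R}$, and this lower bound is sharp.
   Context: $\psi$ is the periodic function of period one with $\psi(x)=1$ if $0<\{x\}\leq\gamma$ and $\psi(x)=0$ if $\gamma<\{x\}<1$ or $x\in\mathbb{Z}$, where $\{x\}$ is the fractional part. $\psi^{(1)}=\psi$ and, for $\kappa\geq2$, $\psi^{(\kappa)}(x)=\int_0^1\psi^{(\kappa-1)}(x-y)\psi(y)\,dy=\int_{x-\gamma}^x\psi^{(\kappa-1)}(y)\,dy$. *)

theory Defs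
  imports "HOL-Analysis.Analysis"
begin

definition psi :: "real \<Rightarrow> real \<Rightarrow> real" where
  "psi \<gamma> x = (if 0 < frac x \<and> frac x \<le> \<gamma> then 1 else 0)"

(* psi_conv gamma k is the k-fold convolution of psi on the circle, indexed from k = 1;
   the value at k = 0 is a dummy. *)
fun psi_conv :: "real \<Rightarrow> nat \<Rightarrow> real \<Rightarrow> real" where
  "psi_conv \<gamma> 0 x = 0"
| "psi_conv \<gamma> (Suc 0) x = psi \<gamma> x"
| "psi_conv \<gamma> (Suc (Suc k)) x =
     integral {0..1} (\<lambda>y. psi_conv \<gamma> (Suc k) (x - y) * psi \<gamma> y)"

end

theory Submission
  imports Defs
begin

text \<open>
  Let \<open>b\<^sub>n\<close> be the \<open>(n + 1)\<close>-fold convolution on the real line of the indicator of \<open>[0, \<gamma>]\<close>. It is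
  supported on \<open>[0, (n + 1) \<gamma>]\<close>, equals \<open>x\<^sup>n / n!\<close> on \<open>[0, \<gamma>]\<close>, and is symmetric and unimodal about
  \<open>(n + 1) \<gamma> / 2\<close>. Since \<open>(\<kappa> - 1) \<gamma> < 1 < \<kappa> \<gamma>\<close>, periodising \<open>b\<^sub>n\<close> with \<open>n = \<kappa> - 1\<close> makes only
  two translates overlap, and only on \<open>[0, \<delta>]\<close> with \<open>\<delta> = \<kappa> \<gamma> - 1 < \<gamma>\<close>. There the sum is
  \<open>(x\<^sup>n + (\<delta> - x)\<^sup>n) / n!\<close>, which by convexity is minimal at \<open>x = \<delta> / 2\<close>; on \<open>[\<delta>, 1]\<close> unimodality
  gives the larger bound \<open>b\<^sub>n \<delta> = \<delta>\<^sup>n / n!\<close>.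
\<close>

section \<open>Cardinal B-splines on the real line\<close>

text \<open>The interval is closed at 0, unlike the set where \<open>psi\<close> is 1, so that
  reflection symmetry and the formula \<open>x ^ n / fact n\<close> hold at the endpoints already
  for \<open>n = 0\<close>.\<close>

fun bspline :: "real \<Rightarrow> nat \<Rightarrow> real \<Rightarrow> real" where
  "bspline \<gamma> 0 x = indicator {0..\<gamma>} x"
| "bspline \<gamma> (Suc n) x = integral {x - \<gamma>..x} (bspline \<gamma> n)"

lemma integral_reflect_shift_real:
  fixes f :: "real \<Rightarrow> real"
  shows "integral {a..b} (\<lambda>y. f (c - y)) = integral {c - b..c - a} f"
proof -
  have "integral {c - b..c - a} f = integral {-b..-a} (\<lambda>x. f (x + c))"
    using integral_shift_real_ivl[of "c - b" c "c - a" f] by simp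
  also have "\<dots> = integral {a..b} (\<lambda>y. f (c - y))"
    using Henstock_Kurzweil_Integration.integral_reflect_real[of b a "\<lambda>y. f (c - y)"] by (simp add: add.commute)
  finally show ?thesis by simp
qed

text \<open>Level 0 jumps; every later level is a difference of two values of one antiderivative
  \<open>G\<close>, hence continuous.\<close>

lemma bspline_integrable:
  assumes "\<gamma> > 0"
  shows "bspline \<gamma> n integrable_on {a..b}"
proof (induction n arbitrary: a b)
  case 0
  have "(indicator {0..\<gamma>} :: real \<Rightarrow> real) integrable_on {a..b}"
    using integrable_on_indicator[of "{0..\<gamma>}" "{a..b}"]
    by (simp add: Int_atLeastAtMost lmeasurable_interval)
  then show ?case by (simp add: fun_eq_iff cong: integrable_cong)
next
  case (Suc n)
  define G where "G x = integral {a - \<gamma>..x} (bspline \<gamma> n)" for x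
  have G: "continuous_on {a - \<gamma>..b} G"
    unfolding G_def by (rule indefinite_integral_continuous_1[OF Suc.IH])
  have "continuous_on {a..b} (\<lambda>x. G x - G (x - \<gamma>))"
    using assms by (intro continuous_intros continuous_on_compose2[OF G]) auto
  moreover have "bspline \<gamma> (Suc n) x = G x - G (x - \<gamma>)" if "x \<in> {a..b}" for x
    using Henstock_Kurzweil_Integration.integral_combine[OF _ _ Suc.IH, of "a - \<gamma>" "x - \<gamma>" x] that assms
    by (simp add: G_def)
  ultimately have "continuous_on {a..b} (bspline \<gamma> (Suc n))"
    by (metis (no_types, lifting) continuous_on_eq)
  then show ?case by (rule integrable_continuous_real)
qed

lemma bspline_nonneg:
  assumes "\<gamma> > 0"
  shows "0 \<le> bspline \<gamma> n x"
proof (induction n arbitrary: x)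
  case (Suc n)
  then show ?case by (simp add: integral_nonneg[OF bspline_integrable[OF assms]])
qed simp

text \<open>The window \<open>{x - \<gamma>..x}\<close> misses the support one level down. The
  inequalities are strict because level 0 is 1 at both endpoints.\<close>

lemma bspline_eq_0:
  assumes "\<gamma> > 0" and "x < 0 \<or> real (Suc n) * \<gamma> < x"
  shows "bspline \<gamma> n x = 0"
  using assms(2)
proof (induction n arbitrary: x)
  case (Suc n)
  have "bspline \<gamma> n y = 0" if "y \<in> {x - \<gamma>..x}" for y
    using Suc.prems that by (intro Suc.IH) (auto simp: algebra_simps)
  then have "integral {x - \<gamma>..x} (bspline \<gamma> n) = integral {x - \<gamma>..x} (\<lambda>_. 0)"
    by (rule integral_cong)
  then show ?case by simp
qed (auto simp: indicator_def)

lemma bspline_symmetric: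
  assumes "\<gamma> > 0"
  shows "bspline \<gamma> n (real (Suc n) * \<gamma> - x) = bspline \<gamma> n x"
proof (induction n arbitrary: x)
  case (Suc n)
  have "integral {x - \<gamma>..x} (bspline \<gamma> n)
      = integral {x - \<gamma>..x} (\<lambda>y. bspline \<gamma> n (real (Suc n) * \<gamma> - y))"
    by (rule integral_cong) (metis Suc.IH)
  also have "\<dots> = integral {real (Suc n) * \<gamma> - x..real (Suc n) * \<gamma> - (x - \<gamma>)} (bspline \<gamma> n)"
    by (rule integral_reflect_shift_real)
  finally show ?case by (simp add: algebra_simps)
qed (auto simp: indicator_def)

text \<open>The part of the window left of 0 contributes nothing, so each level integrates the
  previous monomial from 0 to \<open>x\<close>.\<close>

lemma bspline_power:
  assumes "\<gamma> > 0" and "0 \<le> x" and "x \<le> \<gamma>"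
  shows "bspline \<gamma> n x = x ^ n / fact n"
  using assms(2,3)
proof (induction n arbitrary: x)
  case (Suc n)
  \<comment> \<open>The point 0 is exempted because level 0 equals 1 there.\<close>
  have "integral {x - \<gamma>..0} (bspline \<gamma> n) = integral {x - \<gamma>..0} (\<lambda>_. 0)"
    by (rule integral_spike[of "{0}"]) (auto intro!: bspline_eq_0 simp: assms(1))
  moreover have "integral {0..x} (bspline \<gamma> n) = integral {0..x} (\<lambda>y. y ^ n / fact n)"
    using Suc by (intro integral_cong) auto
  moreover have "((\<lambda>y. y ^ n / fact n) has_integral
      (x ^ Suc n / fact (Suc n) - 0 ^ Suc n / fact (Suc n))) {0..x}"
  proof (rule fundamental_theorem_of_calculus)
    fix y :: real
    show "((\<lambda>y. y ^ Suc n / fact (Suc n)) has_vector_derivative y ^ n / fact n)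
        (at y within {0..x})"
      using DERIV_cdivide[OF DERIV_pow[of "Suc n" y "{0..x}"], of "fact (Suc n)"]
      by (simp add: has_real_derivative_iff_has_vector_derivative del: of_nat_Suc power_Suc)
  qed (use Suc.prems in auto)
  moreover have "integral {x - \<gamma>..0} (bspline \<gamma> n) + integral {0..x} (bspline \<gamma> n)
      = integral {x - \<gamma>..x} (bspline \<gamma> n)"
    using Suc.prems assms(1) by (intro Henstock_Kurzweil_Integration.integral_combine bspline_integrable) auto
  ultimately show ?case by (auto dest: integral_unique)
qed simp

text \<open>The increment from \<open>t\<close> to \<open>s\<close> is an integral over
  \<open>{t..s}\<close> of differences between \<open>y\<close> and \<open>y - \<gamma>\<close> one
  level down. Measuring distance to the centre lets the induction hypothesis compare points on
  opposite sides of it.\<close>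

lemma bspline_unimodal:
  assumes "\<gamma> > 0"
    and "\<bar>s - real (Suc n) * \<gamma> / 2\<bar> \<le> \<bar>t - real (Suc n) * \<gamma> / 2\<bar>"
  shows "bspline \<gamma> n t \<le> bspline \<gamma> n s"
  using assms(2)
proof (induction n arbitrary: s t)
  case 0
  then show ?case by (auto simp: indicator_def abs_if field_simps split: if_splits)
next
  case (Suc n)
  define c where "c = real (Suc (Suc n)) * \<gamma> / 2"
  have mono: "bspline \<gamma> (Suc n) t \<le> bspline \<gamma> (Suc n) s" if "t \<le> s" "s \<le> c" for s t
  proof -
    have "integral {t - \<gamma>..s - \<gamma>} (bspline \<gamma> n) = integral {t..s} (\<lambda>y. bspline \<gamma> n (y - \<gamma>))"
      using integral_shift_real_ivl[of "t - \<gamma>" "- \<gamma>" "s - \<gamma>" "bspline \<gamma> n"] by simp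
    also have "\<dots> \<le> integral {t..s} (bspline \<gamma> n)"
    proof (rule integral_le)
      show "(\<lambda>y. bspline \<gamma> n (y - \<gamma>)) integrable_on {t..s}"
        using integrable_shift_real_ivl[of "bspline \<gamma> n" "t - \<gamma>" "s - \<gamma>" "- \<gamma>"]
          bspline_integrable[OF assms(1)] by simp
      \<comment> \<open>As \<open>y \<le> c\<close>, the midpoint of \<open>y - \<gamma>\<close> and
        \<open>y\<close> does not exceed the lower centre \<open>c - \<gamma> / 2\<close>.\<close>
      show "bspline \<gamma> n (y - \<gamma>) \<le> bspline \<gamma> n y" if "y \<in> {t..s}" for y
        using that \<open>s \<le> c\<close> assms(1)
        by (intro Suc.IH) (auto simp: c_def abs_if field_simps)
    qed (rule bspline_integrable[OF assms(1)])
    finally have "integral {t - \<gamma>..s - \<gamma>} (bspline \<gamma> n) \<le> integral {t..s} (bspline \<gamma> n)" .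
    moreover have "integral {t - \<gamma>..t} (bspline \<gamma> n) + integral {t..s} (bspline \<gamma> n)
        = integral {t - \<gamma>..s} (bspline \<gamma> n)"
      using that assms(1) by (intro Henstock_Kurzweil_Integration.integral_combine bspline_integrable) auto
    moreover have "integral {t - \<gamma>..s - \<gamma>} (bspline \<gamma> n) + integral {s - \<gamma>..s} (bspline \<gamma> n)
        = integral {t - \<gamma>..s} (bspline \<gamma> n)"
      using that assms(1) by (intro Henstock_Kurzweil_Integration.integral_combine bspline_integrable) auto
    ultimately show ?thesis by simp
  qed
  \<comment> \<open>Folding about \<open>c\<close> moves every point to the left half, where
    \<open>mono\<close> applies.\<close>
  have fold: "bspline \<gamma> (Suc n) (c - \<bar>x - c\<bar>) = bspline \<gamma> (Suc n) x" for x
  proof (cases "x \<le> c")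
    case False
    then have "c - \<bar>x - c\<bar> = real (Suc (Suc n)) * \<gamma> - x"
      by (simp add: c_def)
    then show ?thesis by (simp only: bspline_symmetric[OF assms(1)])
  qed simp
  have "c - \<bar>t - c\<bar> \<le> c - \<bar>s - c\<bar>"
    using Suc.prems by (simp add: c_def)
  from mono[OF this] show ?case by (simp only: fold)
qed

section \<open>Periodisation: from the real line to the circle\<close>

lemma psi_conv_plus_1: "psi_conv \<gamma> k (x + 1) = psi_conv \<gamma> k x"
proof (induction \<gamma> k x rule: psi_conv.induct)
  case (2 \<gamma> x)
  then show ?case by (simp add: psi_def frac_1_eq)
next
  case (3 \<gamma> k x)
  have "psi_conv \<gamma> (Suc k) (x + 1 - y) = psi_conv \<gamma> (Suc k) (x - y)" for y
    using 3[of y] by (simp add: algebra_simps)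
  then show ?case by simp
qed simp

lemma psi_conv_frac: "psi_conv \<gamma> k (frac x) = psi_conv \<gamma> k x"
proof -
  have nat: "psi_conv \<gamma> k (x + real n) = psi_conv \<gamma> k x" for n x
  proof (induction n)
    case (Suc n)
    have "x + real (Suc n) = x + real n + 1" by simp
    then show ?case by (simp only: psi_conv_plus_1 Suc.IH)
  qed simp
  show ?thesis
  proof (cases "\<lfloor>x\<rfloor> \<ge> 0")
    case True
    then show ?thesis using nat[of "frac x" "nat \<lfloor>x\<rfloor>"] by (simp add: frac_def)
  next
    case False
    then show ?thesis using nat[of x "nat (- \<lfloor>x\<rfloor>)"] by (simp add: frac_def)
  qed
qed

text \<open>The hypothesis excludes \<open>x = 0\<close> because for \<open>n = 0\<close> it fails there: \<open>psi\<close> vanishes at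
  integers. Convolution repairs the endpoint.\<close>

lemma psi_conv_eq_bspline_step:
  assumes \<gamma>: "0 < \<gamma>" "\<gamma> < 1" and small: "real (Suc n) * \<gamma> < 1"
    and x: "0 \<le> x" "x < 1"
    and IH: "\<And>x. 0 < x \<Longrightarrow> x < 1 \<Longrightarrow>
      psi_conv \<gamma> (Suc n) x = bspline \<gamma> n x + bspline \<gamma> n (x + 1)"
  shows "psi_conv \<gamma> (Suc (Suc n)) x = bspline \<gamma> (Suc n) x + bspline \<gamma> (Suc n) (x + 1)"
proof -
  let ?b = "bspline \<gamma> n"
  have eq: "psi_conv \<gamma> (Suc n) (x - y) = ?b (x - y) + ?b (x + 1 - y)"
    if y: "0 < y" "y < 1" "y \<noteq> x" for y
  proof (cases "y < x")
    case True
    then show ?thesis using IH[of "x - y"] x y by (simp add: algebra_simps)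
  next
    case False
    \<comment> \<open>After wrapping around by 1, \<open>x - y\<close> is negative and
      \<open>x - y + 2\<close> exceeds 1, so both lie outside the support.\<close>
    have "psi_conv \<gamma> (Suc n) (x - y) = psi_conv \<gamma> (Suc n) (x - y + 1)"
      by (simp only: psi_conv_plus_1)
    also have "\<dots> = ?b (x - y + 1) + ?b (x - y + 1 + 1)"
      using False x y by (intro IH) auto
    also have "?b (x - y + 1 + 1) = 0"
      using small x y by (intro bspline_eq_0[OF \<gamma>(1)]) auto
    also have "0 = ?b (x - y)"
      using False y by (intro bspline_eq_0[OF \<gamma>(1), symmetric]) auto
    finally show ?thesis by (simp add: algebra_simps)
  qed
  have refl: "(\<lambda>y. ?b (c - y)) integrable_on {a..b}" for a b c
  proof -
    have "(\<lambda>y. ?b (y + c)) integrable_on {(c - b) - c..(c - a) - c}"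
      by (intro integrable_shift_real_ivl bspline_integrable[OF \<gamma>(1)])
    then have "(\<lambda>y. ?b (y + c)) integrable_on {-b..-a}" by simp
    then show ?thesis
      using Henstock_Kurzweil_Integration.integrable_reflect_real[of "\<lambda>y. ?b (c - y)" b a] by (simp add: add.commute)
  qed
  let ?h = "\<lambda>y. ?b (x - y) + ?b (x + 1 - y)"
  have "psi_conv \<gamma> (Suc (Suc n)) x = integral {0..1} (\<lambda>y. if y \<in> {0..\<gamma>} then ?h y else 0)"
  \<comment> \<open>Off these three points \<open>psi\<close> is the indicator of
    \<open>{0..\<gamma>}\<close> and \<open>eq\<close> applies; at \<open>y = 0\<close> the
    integrands can differ.\<close>
  proof (simp only: psi_conv.simps, rule integral_spike[of "{0, 1, x}"])
    fix y assume "y \<in> {0..1} - {0, 1, x}"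
    then have y: "0 < y" "y < 1" "y \<noteq> x" by auto
    moreover have "frac y = y" using y by (simp add: frac_eq)
    ultimately show "(if y \<in> {0..\<gamma>} then ?h y else 0) = psi_conv \<gamma> (Suc n) (x - y) * psi \<gamma> y"
      using eq[OF y] by (auto simp: psi_def)
  qed auto
  also have "\<dots> = integral {0..\<gamma>} ?h"
    using \<gamma> by (simp only: integral_restrict_Int) (simp add: Int_atLeastAtMost)
  also have "\<dots> = integral {0..\<gamma>} (\<lambda>y. ?b (x - y)) + integral {0..\<gamma>} (\<lambda>y. ?b (x + 1 - y))"
    by (intro integral_add refl)
  also have "\<dots> = bspline \<gamma> (Suc n) x + bspline \<gamma> (Suc n) (x + 1)"
    by (simp add: integral_reflect_shift_real[of 0 \<gamma> ?b])
  finally show ?thesis .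
qed

lemma psi_conv_eq_bspline_interior:
  assumes \<gamma>: "0 < \<gamma>" "\<gamma> < 1" and "real n * \<gamma> < 1" and "0 < x" "x < 1"
  shows "psi_conv \<gamma> (Suc n) x = bspline \<gamma> n x + bspline \<gamma> n (x + 1)"
  using assms(3-5)
proof (induction n arbitrary: x)
  case 0
  then have "frac x = x" by (simp add: frac_eq)
  with 0 \<gamma> show ?case by (auto simp: psi_def indicator_def)
next
  case (Suc n)
  have "real n * \<gamma> < 1" using Suc.prems(1) \<gamma> by (simp add: algebra_simps)
  with Suc show ?case by (intro psi_conv_eq_bspline_step[OF \<gamma>]) auto
qed

text \<open>One final convolution step recovers \<open>x = 0\<close>. The bound on
  \<open>real n * \<gamma>\<close> concerns the support one level down; the support of level
  \<open>n\<close> itself may be longer than 1, which produces the overlap.\<close>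

lemma psi_conv_eq_bspline:
  assumes \<gamma>: "0 < \<gamma>" "\<gamma> < 1" and n: "0 < n" "real n * \<gamma> < 1" and x: "0 \<le> x" "x < 1"
  shows "psi_conv \<gamma> (Suc n) x = bspline \<gamma> n x + bspline \<gamma> n (x + 1)"
proof -
  obtain m where m: "n = Suc m" using n(1) gr0_implies_Suc by blast
  have "real m * \<gamma> < 1" using n(2) \<gamma> by (simp add: m algebra_simps)
  with n(2) show ?thesis unfolding m
    by (intro psi_conv_eq_bspline_step[OF \<gamma> _ x] psi_conv_eq_bspline_interior[OF \<gamma>]) auto
qed

section \<open>Convexity and the sharp lower bound\<close>

lemma power_mean_two:
  fixes a b :: real
  assumes "0 \<le> a" "0 \<le> b"
  shows "((a + b) / 2) ^ n \<le> (a ^ n + b ^ n) / 2"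
proof -
  have "convex_on {0..} (\<lambda>x::real. x ^ n)"
  proof (cases "even n")
    case True
    then show ?thesis by (rule convex_on_subset[OF convex_power_even]) auto
  qed (rule convex_power_odd)
  from convex_onD[OF this, of "1/2" a b] assms show ?thesis
    by (simp add: field_simps)
qed

theorem theorem5p7:
  fixes \<alpha> \<gamma> :: real and \<kappa> :: nat
  assumes "\<alpha> > 1" and "\<alpha> \<notin> \<rat>" and "\<gamma> = inverse \<alpha>" and "int \<kappa> = \<lceil>\<alpha>\<rceil>"
  shows "(\<forall>x. psi_conv \<gamma> \<kappa> x \<ge> (real \<kappa> * \<gamma> - 1) ^ (\<kappa> - 1) / (2 ^ (\<kappa> - 2) * fact (\<kappa> - 1))) \<and>
         (\<exists>x. psi_conv \<gamma> \<kappa> x = (real \<kappa> * \<gamma> - 1) ^ (\<kappa> - 1) / (2 ^ (\<kappa> - 2) * fact (\<kappa> - 1)))"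
proof -
  have \<gamma>: "0 < \<gamma>" "\<gamma> < 1" using assms(1,3) by (simp_all add: inverse_less_1_iff)
  have "\<alpha> \<le> real \<kappa>" "real \<kappa> < \<alpha> + 1"
    using assms(4) by linarith+
  \<comment> \<open>Irrationality makes \<open>\<alpha> < \<kappa>\<close> strict, which becomes
    \<open>\<delta> > 0\<close>; \<open>\<kappa> - 1 < \<alpha>\<close> becomes
    \<open>n * \<gamma> < 1\<close>.\<close>
  moreover have "\<alpha> \<noteq> real \<kappa>" using assms(2) by auto
  ultimately have \<alpha>: "\<alpha> < real \<kappa>" "real \<kappa> - 1 < \<alpha>" by auto
  \<comment> \<open>This keeps the natural subtraction \<open>\<kappa> - 2\<close> exact and makes
    \<open>n\<close> positive, so that the endpoint 0 is covered.\<close>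
  then have "1 < \<kappa>" using assms(1) by linarith
  define m where "m = \<kappa> - 2"
  define n where "n = Suc m"
  have \<kappa>: "\<kappa> = Suc n" "\<kappa> - 1 = n" "\<kappa> - 2 = m"
    using \<open>1 < \<kappa>\<close> by (auto simp: m_def n_def)
  define \<delta> where "\<delta> = real \<kappa> * \<gamma> - 1"
  have n\<gamma>: "real n * \<gamma> < 1" and \<delta>: "0 < \<delta>"
    using \<alpha> assms(1) by (simp_all add: assms(3) \<delta>_def \<kappa>(1) field_simps)
  have \<delta>\<gamma>: "\<delta> < \<gamma>" using n\<gamma> by (simp add: \<delta>_def \<kappa>(1) algebra_simps)
  define B where "B = \<delta> ^ n / (2 ^ m * fact n)"
  \<comment> \<open>The two overlap terms agree at \<open>\<delta> / 2\<close>, and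
    \<open>2 / 2 ^ n = 1 / 2 ^ m\<close>.\<close>
  have B: "B = 2 * (\<delta> / 2) ^ n / fact n"
    by (simp add: B_def n_def power_divide)
  have conv: "psi_conv \<gamma> \<kappa> x = bspline \<gamma> n x + bspline \<gamma> n (x + 1)" if "0 \<le> x" "x < 1" for x
    unfolding \<kappa>(1) using that n\<gamma> by (intro psi_conv_eq_bspline \<gamma>) (auto simp: n_def)
  have overlap: "psi_conv \<gamma> \<kappa> x = (x ^ n + (\<delta> - x) ^ n) / fact n" if x: "0 \<le> x" "x \<le> \<delta>" for x
  proof -
    \<comment> \<open>The support has length \<open>1 + \<delta>\<close>, so reflection sends
      \<open>x + 1\<close> to \<open>\<delta> - x\<close>.\<close>
    have "bspline \<gamma> n (x + 1) = bspline \<gamma> n (\<delta> - x)"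
      using bspline_symmetric[OF \<gamma>(1), of n "x + 1"] by (simp add: \<delta>_def \<kappa>(1) algebra_simps)
    then show ?thesis
      using conv[of x] bspline_power[OF \<gamma>(1), of x n] bspline_power[OF \<gamma>(1), of "\<delta> - x" n]
        x \<delta>\<gamma> \<gamma> by (simp add: add_divide_distrib)
  qed
  have "B \<le> psi_conv \<gamma> \<kappa> x" if x: "0 \<le> x" "x < 1" for x
  proof (cases "x \<le> \<delta>")
    case True
    have "2 * (\<delta> / 2) ^ n \<le> x ^ n + (\<delta> - x) ^ n"
      using power_mean_two[of x "\<delta> - x" n] x True by simp
    then show ?thesis
      using overlap[OF x(1) True] by (simp add: B divide_right_mono)
  next
    case False
    have "B \<le> \<delta> ^ n / fact n"
      unfolding B_def using \<delta> by (intro divide_left_mono) auto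
    also have "\<dots> = bspline \<gamma> n \<delta>"
      using bspline_power[OF \<gamma>(1), of \<delta> n] \<delta> \<delta>\<gamma> by simp
    also have "\<dots> \<le> bspline \<gamma> n x"
    proof (rule bspline_unimodal[OF \<gamma>(1)])
      \<comment> \<open>The interval \<open>{\<delta>..1}\<close> is symmetric about the centre
        \<open>(1 + \<delta>) / 2\<close>, so none of its points is farther from it than
        \<open>\<delta>\<close>.\<close>
      have "real (Suc n) * \<gamma> = 1 + \<delta>" by (simp add: \<delta>_def \<kappa>(1))
      then show "\<bar>x - real (Suc n) * \<gamma> / 2\<bar> \<le> \<bar>\<delta> - real (Suc n) * \<gamma> / 2\<bar>"
        using False x by (simp only: abs_if) (auto simp: field_simps)
    qed
    also have "\<dots> \<le> psi_conv \<gamma> \<kappa> x"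
      using conv[OF x] bspline_nonneg[OF \<gamma>(1)] by simp
    finally show ?thesis .
  qed
  then have "B \<le> psi_conv \<gamma> \<kappa> x" for x
    using psi_conv_frac[of \<gamma> \<kappa> x] frac_ge_0[of x] frac_lt_1[of x] by metis
  moreover have "psi_conv \<gamma> \<kappa> (\<delta> / 2) = B"
    using overlap[of "\<delta> / 2"] \<delta> by (simp add: B)
  ultimately show ?thesis
    unfolding \<kappa>(2,3) \<delta>_def[symmetric] B_def[symmetric] by blast
qed

end
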